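(* Let $m,s$ be such that $m/\gcd(m,s)$ is even, let $d=\gcd(m,s)$, and let $0\neq l\in L^*\setminus(L^* )^{\sigma-1}$. Then for every legitimate quadruple $t$ the presemifield $B(2,m,s,l,t)$ belongs to the C-family. The group $G_1=GL(2,L)\times L^*$ has exactly $2^{d-1}$ orbits on the set $\Omega(m,s)$ of legitimate quadruples.
   Context: A (finite) presemifield is a finite additive abelian group with a multiplication that is distributive on both sides over addition and has no zero divisors. Two presemifields $(F,+,* )$ and $(F,+,\circ)$ are isotopic if there are additive bijections $\alpha_1,\alpha_2,\beta$ with $\beta(\alpha_1(x)*\alpha_2(y))=x\circ y$ for all $x,y$. Let $m\ge 1$, $L=GF(2^m)$, $0\le s<2m$, $\sigma=2^s$, $(L^* )^{\sigma-1}=\{u^{\sigma-1}:u\in L^*\}$. A quadruple $t=[p_1,p_2,p_3,p_4]\in L^4$ is legitimate if $p_1\neq0$ and $p_1X^{\sigma+1}+p_2X^{\sigma}+p_3X+p_4$ has no root in $L$; $\Omega(m,s)$ is the set of legitimate quadruples. For legitimate $t$ and for $l=0$ or $l\in L^*\setminus(L^* )^{\sigma-1}$, $B(2,m,s,l,t)$ is the presemifield on $L\times L$ with multiplication $$(a,b)\circ(c,d)=(p_1ac^{\sigma}+lp_1a^{\sigma}c+p_2bc^{\sigma}+lp_2a^{\sigma}d+p_3ad^{\sigma}+lp_3b^{\sigma}c+p_4bd^{\sigma}+lp_4b^{\sigma}d,\ ad+bc).$$ For given $m,s$, the C-family consists of the (pre)semifields isotopic to some $B(2,m,s,l,[1,0,0,p_4])$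 with $l\neq0$ (and $[1,0,0,p_4]$ legitimate). The group $G_1=GL(2,L)\times L^*$ acts on $\Omega(m,s)$ as follows: $\lambda\in L^*$ maps $[p_1,p_2,p_3,p_4]$ to $[\lambda p_1,\lambda p_2,\lambda p_3,\lambda p_4]$, and $\begin{pmatrix}\alpha&\beta\\ \gamma&\delta\end{pmatrix}\in GL(2,L)$ maps it to $[p_1',p_2',p_3',p_4']$ where $p_1'=\alpha^{\sigma+1}p_1+\alpha^{\sigma}\gamma p_2+\alpha\gamma^{\sigma}p_3+\gamma^{\sigma+1}p_4$, $p_2'=\alpha^{\sigma}\beta p_1+\alpha^{\sigma}\delta p_2+\beta\gamma^{\sigma}p_3+\gamma^{\sigma}\delta p_4$, $p_3'=\alpha\beta^{\sigma}p_1+\beta^{\sigma}\gamma p_2+\alpha\delta^{\sigma}p_3+\gamma\delta^{\sigma}p_4$, $p_4'=\beta^{\sigma+1}p_1+\beta^{\sigma}\delta p_2+\beta\delta^{\sigma}p_3+\delta^{\sigma+1}p_4$. *)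

theory Defs
  imports "HOL-Analysis.Determinants" "HOL-Library.Product_Plus"
begin

definition presemifield :: "('f::{ab_group_add,finite} \<Rightarrow> 'f \<Rightarrow> 'f) \<Rightarrow> bool" where
  "presemifield mul \<longleftrightarrow>
     (\<forall>x y z. mul x (y + z) = mul x y + mul x z) \<and>
     (\<forall>x y z. mul (x + y) z = mul x z + mul y z) \<and>
     (\<forall>x y. mul x y = 0 \<longrightarrow> x = 0 \<or> y = 0)"

definition isotopic :: "('f::ab_group_add \<Rightarrow> 'f \<Rightarrow> 'f) \<Rightarrow> ('f \<Rightarrow> 'f \<Rightarrow> 'f) \<Rightarrow> bool" where
  "isotopic mul mul' \<longleftrightarrow>
     (\<exists>\<alpha>1 \<alpha>2 \<beta>. additive \<alpha>1 \<and> bij \<alpha>1 \<and> additive \<alpha>2 \<and> bij \<alpha>2 \<and> additive \<beta> \<and> bij \<beta> \<and>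
        (\<forall>x y. \<beta> (mul (\<alpha>1 x) (\<alpha>2 y)) = mul' x y))"

text \<open>
  The field \<open>L = GF(2^m)\<close> is a type \<open>'a\<close> of class \<open>field\<close> and \<open>finite\<close> with
  \<open>CARD('a) = 2 ^ m\<close>; the parameter \<open>m\<close> is therefore carried by the type.  Throughout,
  the exponent \<open>\<sigma>\<close> is \<open>2 ^ s\<close>.
\<close>

type_synonym 'a quadruple = "'a \<times> 'a \<times> 'a \<times> 'a"

definition sigma_powers :: "nat \<Rightarrow> 'a::field set" where
  "sigma_powers s = {u ^ (2 ^ s - 1) | u. u \<noteq> 0}"

definition legitimate :: "nat \<Rightarrow> 'a::field quadruple \<Rightarrow> bool" where
  "legitimate s = (\<lambda>(p1, p2, p3, p4).
     p1 \<noteq> 0 \<and>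
     (\<nexists>x. p1 * x ^ (2 ^ s + 1) + p2 * x ^ (2 ^ s) + p3 * x + p4 = 0))"

definition Omega :: "nat \<Rightarrow> 'a::field quadruple set" where
  "Omega s = {t. legitimate s t}"

definition B :: "nat \<Rightarrow> 'a::field \<Rightarrow> 'a quadruple \<Rightarrow> 'a \<times> 'a \<Rightarrow> 'a \<times> 'a \<Rightarrow> 'a \<times> 'a" where
  "B s l = (\<lambda>(p1, p2, p3, p4) (a, b) (c, d). let \<sigma> = 2 ^ s in
     (p1 * a * c ^ \<sigma> + l * p1 * a ^ \<sigma> * c + p2 * b * c ^ \<sigma> + l * p2 * a ^ \<sigma> * d
        + p3 * a * d ^ \<sigma> + l * p3 * b ^ \<sigma> * c + p4 * b * d ^ \<sigma> + l * p4 * b ^ \<sigma> * d,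
      a * d + b * c))"

definition C_family :: "nat \<Rightarrow> ('a::{field,finite} \<times> 'a \<Rightarrow> 'a \<times> 'a \<Rightarrow> 'a \<times> 'a) set" where
  "C_family s = {mul. presemifield mul \<and>
     (\<exists>l p4. l \<noteq> 0 \<and> l \<notin> sigma_powers s \<and> legitimate s (1, 0, 0, p4) \<and>
        isotopic (B s l (1, 0, 0, p4)) mul)}"

definition G1 :: "(('a::field ^ 2 ^ 2) \<times> 'a) set" where
  "G1 = {A. invertible A} \<times> (UNIV - {0})"

definition scalar_act :: "'a::field \<Rightarrow> 'a quadruple \<Rightarrow> 'a quadruple" where
  "scalar_act c = (\<lambda>(p1, p2, p3, p4). (c * p1, c * p2, c * p3, c * p4))"

text \<open>
  The formula is the substitution of \<open>(\<alpha>x + \<beta>y, \<gamma>x + \<delta>y)\<close> for \<open>(x, y)\<close> in the form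
  \<open>p1 x^(\<sigma>+1) + p2 x^\<sigma> y + p3 x y^\<sigma> + p4 y^(\<sigma>+1)\<close>; with the usual matrix product
  this is a right action.
\<close>

definition matrix_act :: "nat \<Rightarrow> 'a::field ^ 2 ^ 2 \<Rightarrow> 'a quadruple \<Rightarrow> 'a quadruple" where
  "matrix_act s A = (\<lambda>(p1, p2, p3, p4).
     let \<sigma> = 2 ^ s; \<alpha> = A $ 1 $ 1; \<beta> = A $ 1 $ 2; \<gamma> = A $ 2 $ 1; \<delta> = A $ 2 $ 2 in
     (\<alpha> ^ (\<sigma> + 1) * p1 + \<alpha> ^ \<sigma> * \<gamma> * p2 + \<alpha> * \<gamma> ^ \<sigma> * p3 + \<gamma> ^ (\<sigma> + 1) * p4,
      \<alpha> ^ \<sigma> * \<beta> * p1 + \<alpha> ^ \<sigma> * \<delta> * p2 + \<beta> * \<gamma> ^ \<sigma> * p3 + \<gamma> ^ \<sigma> * \<delta> * p4,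
      \<alpha> * \<beta> ^ \<sigma> * p1 + \<beta> ^ \<sigma> * \<gamma> * p2 + \<alpha> * \<delta> ^ \<sigma> * p3 + \<gamma> * \<delta> ^ \<sigma> * p4,
      \<beta> ^ (\<sigma> + 1) * p1 + \<beta> ^ \<sigma> * \<delta> * p2 + \<beta> * \<delta> ^ \<sigma> * p3 + \<delta> ^ (\<sigma> + 1) * p4))"

definition G1_act :: "nat \<Rightarrow> ('a::field ^ 2 ^ 2) \<times> 'a \<Rightarrow> 'a quadruple \<Rightarrow> 'a quadruple" where
  "G1_act s = (\<lambda>(A, c) t. scalar_act c (matrix_act s A t))"

definition G1_orbit :: "nat \<Rightarrow> 'a::field quadruple \<Rightarrow> 'a quadruple set" where
  "G1_orbit s t = {G1_act s g t | g. g \<in> G1}"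

definition G1_orbits :: "nat \<Rightarrow> 'a::field quadruple set set" where
  "G1_orbits s = {G1_orbit s t | t. t \<in> Omega s}"

end

theory Submission
  imports Defs "HOL-Computational_Algebra.Polynomial"
begin

text \<open>
  A quadruple is a form \<open>f(u) = M(u, u)\<close> on \<open>L\<^sup>2\<close>, where \<open>M(u, v)\<close> is \<open>\<sigma>\<close>-semilinear in \<open>u\<close> and
  linear in \<open>v\<close>; legitimate means anisotropic, and \<open>G\<^sub>1\<close> acts by change of basis and scaling.
  Since \<open>B(2,m,s,l,t)\<close> sends \<open>(u, v)\<close> to \<open>(M(v, u) + l M(u, v), det(u, v))\<close>, quadruples in the
  same orbit give isotopic presemifields with the same \<open>l\<close>, and the first claim reduces to
  diagonalising \<open>f\<close>.

  Let \<open>\<chi>\<close> be a nontrivial additive character of \<open>L\<close> with values \<open>1\<close> and \<open>-1\<close>, and put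
  \<open>S(\<kappa>) = \<Sum>\<^sub>v \<chi>(\<kappa> f(v))\<close>. The \<open>q + 1\<close> roots of unity of order dividing \<open>\<sigma> + 1\<close>, where
  \<open>q = 2^gcd(m,s)\<close>, act freely on the nonzero \<open>v\<close> and preserve \<open>f\<close>, so \<open>S(\<kappa>) \<equiv> 1\<close> modulo
  \<open>q + 1\<close>. If for no \<open>\<kappa> \<noteq> 0\<close> the symmetric biadditive form
  \<open>\<chi>(\<kappa>(M(u, w) + M(w, u)))\<close> had a radical, then \<open>S(\<kappa>)\<^sup>2 = 4^m\<close>, and the congruence (as
  \<open>2^m \<equiv> 1\<close> modulo \<open>q + 1 > 2\<close>) would force \<open>S(\<kappa>) = 2^m\<close> for all \<open>\<kappa> \<noteq> 0\<close>. This contradicts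
  \<open>\<Sum>\<^sub>\<kappa> S(\<kappa>) = 2^m\<close>, which expresses that \<open>f\<close> is anisotropic. A vector \<open>w\<close> in a radical
  together with a vector \<open>u\<close> such that \<open>M(w, u) = 0\<close> is an orthogonal basis.

  Finally \<open>[1,0,0,p]\<close> and \<open>[1,0,0,p']\<close> are in the same orbit iff \<open>p'\<close> lies in
  \<open>p H \<union> p\<^sup>-\<^sup>1 H\<close>, where \<open>H\<close> is the group of \<open>(\<sigma>+1)\<close>-th powers, of odd index \<open>q + 1\<close>: the
  \<open>q\<close> nontrivial cosets of \<open>H\<close> form \<open>q/2\<close> pairs.
\<close>

subsection \<open>Finite fields of characteristic two\<close>

lemma sum_fibres_eq:
  fixes h :: "'b \<Rightarrow> 'c::comm_semiring_1"
  assumes "finite S" and "\<And>y. y \<in> g ` S \<Longrightarrow> card {x \<in> S. g x = y} = k"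
  shows "(\<Sum>x\<in>S. h (g x)) = of_nat k * (\<Sum>y\<in>g ` S. h y)"
proof -
  have "(\<Sum>x\<in>S. h (g x)) = (\<Sum>y\<in>g ` S. \<Sum>x | x \<in> S \<and> g x = y. h (g x))"
    by (rule sum.image_gen[OF assms(1)])
  also have "\<dots> = (\<Sum>y\<in>g ` S. of_nat k * h y)"
    by (intro sum.cong refl) (simp add: assms(2))
  finally show ?thesis by (simp add: sum_distrib_left)
qed

lemma card_fibres_eq:
  assumes "finite S" and "\<And>y. y \<in> g ` S \<Longrightarrow> card {x \<in> S. g x = y} = k"
  shows "card S = k * card (g ` S)"
  using sum_fibres_eq[of S g k "\<lambda>_. 1::nat", OF assms] by simp

section \<open>Roots of unity and power maps on the units of a finite field\<close>

lemma card_roots_of_unity_le: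
  assumes "k > 0"
  shows "card {x::'a::{field,finite}. x ^ k = 1} \<le> k"
proof -
  define p where "p = monom 1 k - (1::'a poly)"
  have "coeff p k = 1" using assms by (simp add: p_def)
  then have "p \<noteq> 0" by auto
  then have "card {x. poly p x = 0} \<le> degree p" by (rule card_poly_roots_bound)
  also have "degree p \<le> k"
    unfolding p_def by (intro degree_diff_le) (auto simp: degree_monom_le)
  also have "{x. poly p x = 0} = {x. x ^ k = 1}" by (simp add: p_def poly_monom)
  finally show ?thesis .
qed

lemma power_card_minus_1_eq_1:
  fixes x :: "'a::{field,finite}"
  assumes "x \<noteq> 0"
  shows "x ^ (CARD('a) - 1) = 1"
proof -
  have "(\<Prod>y\<in>UNIV - {0}. x * y) = (\<Prod>y\<in>UNIV - {0}. y)"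
    by (rule prod.reindex_bij_witness[of _ "\<lambda>y. y / x" "\<lambda>y. x * y"]) (use assms in auto)
  then have "x ^ (CARD('a) - 1) * \<Prod>(UNIV - {0}) = \<Prod>(UNIV - {0})"
    by (simp add: prod.distrib)
  then show ?thesis by simp
qed

text \<open>For \<open>k = 2 ^ s + 1\<close> this is the group \<open>H\<close> of the
  overview.\<close>

definition unit_powers :: "nat \<Rightarrow> 'a::field set" where
  "unit_powers k = (\<lambda>x. x ^ k) ` (UNIV - {0})"

lemma power_in_unit_powers: "x \<noteq> 0 \<Longrightarrow> x ^ k \<in> unit_powers k"
  by (auto simp: unit_powers_def)

lemma unit_powers_mult: "x \<in> unit_powers k \<Longrightarrow> y \<in> unit_powers k \<Longrightarrow> x * y \<in> unit_powers k"
  unfolding unit_powers_def by (auto simp flip: power_mult_distrib)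

lemma unit_powers_inverse: "x \<in> unit_powers k \<Longrightarrow> inverse x \<in> unit_powers k"
  unfolding unit_powers_def by (auto simp flip: power_inverse)

lemma unit_powers_nonzero: "x \<in> unit_powers k \<Longrightarrow> x \<noteq> 0"
  by (auto simp: unit_powers_def)

text \<open>Division by one preimage moves a fibre of the power map onto the kernel. The kernel
  carries \<open>x \<noteq> 0\<close> because \<open>0 ^ 0 = 1\<close>.\<close>

lemma card_power_fibre:
  fixes y :: "'a::{field,finite}"
  assumes "y \<in> unit_powers k"
  shows "card {x \<in> UNIV - {0}. x ^ k = y} = card {x::'a. x ^ k = 1 \<and> x \<noteq> 0}"
proof -
  obtain z where z: "z \<noteq> 0" "y = z ^ k" using assms by (auto simp: unit_powers_def)
  show ?thesis
    by (rule bij_betw_same_card[of "\<lambda>x. x / z"], rule bij_betw_byWitness[where f' = "\<lambda>x. x * z"])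
      (use z in \<open>auto simp: power_divide power_mult_distrib\<close>)
qed

lemma card_units: "card (UNIV - {0::'a::{field,finite}}) = CARD('a) - 1"
  by (simp add: card_Diff_subset)

lemma card_units_eq_mult:
  "CARD('a) - 1 = card {x::'a::{field,finite}. x ^ k = 1 \<and> x \<noteq> 0} * card (unit_powers k :: 'a set)"
  unfolding card_units[symmetric] unit_powers_def
  by (rule card_fibres_eq) (use card_power_fibre[where 'a='a] in \<open>auto simp: unit_powers_def\<close>)

text \<open>Let \<open>k * j\<close> be the number of units. The \<open>k\<close>-th powers are
  \<open>j\<close>-th roots of unity, so there are at most \<open>j\<close> of them; with fewer than
  \<open>k\<close> roots of unity in the kernel, kernel times image would be too small.\<close>

lemma card_roots_of_unity:
  assumes "k dvd CARD('a) - 1" and "k > 0"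
  shows "card {x::'a::{field,finite}. x ^ k = 1} = k"
proof (rule ccontr)
  define R where "R = card {x::'a. x ^ k = 1}"
  assume "card {x::'a. x ^ k = 1} \<noteq> k"
  then have "R < k" using card_roots_of_unity_le[OF assms(2), where 'a='a] by (simp add: R_def)
  have R: "{x::'a. x ^ k = 1 \<and> x \<noteq> 0} = {x. x ^ k = 1}"
    using assms(2) by (auto simp: zero_power)
  have "card {0, 1::'a} \<le> CARD('a)" by (intro card_mono) auto
  then have "CARD('a) - 1 > 0" by simp
  obtain j where j: "CARD('a) - 1 = k * j" using assms(1) by auto
  have "j > 0" using j \<open>CARD('a) - 1 > 0\<close> by (cases j) auto
  have "(unit_powers k :: 'a set) \<subseteq> {x. x ^ j = 1}"
    using power_card_minus_1_eq_1[where 'a='a] j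
    by (auto simp: unit_powers_def simp flip: power_mult)
  then have "card (unit_powers k :: 'a set) \<le> card {x::'a. x ^ j = 1}"
    by (intro card_mono) auto
  then have "card (unit_powers k :: 'a set) \<le> j"
    using card_roots_of_unity_le[OF \<open>j > 0\<close>, where 'a='a] by linarith
  then have "R * card (unit_powers k :: 'a set) \<le> R * j" by simp
  also have "\<dots> < k * j" using \<open>R < k\<close> \<open>j > 0\<close> by simp
  finally show False using card_units_eq_mult[of k, where 'a='a] j by (simp add: R R_def)
qed

text \<open>Translation by \<open>z\<close> leaves the sum unchanged but multiplies it by
  \<open>\<psi> z\<close>.\<close>

lemma sum_character_eq_0:
  fixes \<psi> :: "'g::{ab_group_add,finite} \<Rightarrow> int"
  assumes "\<And>x y. \<psi> (x + y) = \<psi> x * \<psi> y" and "\<psi> z \<noteq> 1"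
  shows "(\<Sum>x\<in>UNIV. \<psi> x) = 0"
proof -
  have "(\<Sum>x\<in>UNIV. \<psi> x) = (\<Sum>x\<in>UNIV. \<psi> (x + z))"
    by (rule sum.reindex_bij_witness[of _ "\<lambda>x. x + z" "\<lambda>x. x - z"]) auto
  also have "\<dots> = \<psi> z * (\<Sum>x\<in>UNIV. \<psi> x)"
    by (simp add: assms(1) sum_distrib_left mult.commute)
  finally show ?thesis using assms(2) by simp
qed

section \<open>Characteristic two, Frobenius maps and an additive character\<close>

locale binary_field =
  fixes m :: nat and ty :: "'a::{field,finite} itself"
  assumes card_field: "CARD('a) = 2 ^ m"
begin

text \<open>Shifting all elements by \<open>1\<close> preserves their sum, so the order of the field
  vanishes in it; that order is a power of two.\<close>

lemma add_self [simp]: "x + x = (0::'a)"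
proof -
  have "(\<Sum>x\<in>UNIV. x + 1) = (\<Sum>x\<in>UNIV. x::'a)"
    by (rule sum.reindex_bij_witness[of _ "\<lambda>y. y - 1" "\<lambda>y. y + 1"]) auto
  then have "of_nat CARD('a) = (0::'a)" by (simp add: sum.distrib)
  then have "(2::'a) = 0" by (simp add: card_field)
  then show ?thesis by (metis mult_2 mult_zero_left)
qed

lemma add_self_left [simp]: "x + (x + y) = (y::'a)"
  by (simp flip: add.assoc)

lemma minus_eq [simp]: "- x = (x::'a)"
  by (rule minus_unique) (rule add_self)

lemma diff_eq_add [simp]: "x - y = x + (y::'a)"
  using diff_conv_add_uminus[of x y] by simp

lemma add_eq_0_iff_eq: "x + y = 0 \<longleftrightarrow> x = (y::'a)"
  using diff_eq_add[of x y] by (metis right_minus_eq)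

lemma power2_add: "(x + y :: 'a) ^ 2 = x ^ 2 + y ^ 2"
  by (simp add: power2_eq_square algebra_simps)

lemma frob_add: "(x + y :: 'a) ^ 2 ^ k = x ^ 2 ^ k + y ^ 2 ^ k"
  by (induction k) (simp_all add: power_mult power2_add mult.commute[of 2])

lemma frob_inj: "x ^ 2 ^ k = y ^ 2 ^ k \<Longrightarrow> x = (y::'a)"
  by (metis add_eq_0_iff_eq frob_add power_eq_0_iff)

lemma frob_surj: "\<exists>x. (y::'a) = x ^ 2 ^ k"
proof -
  have "inj (\<lambda>x::'a. x ^ 2 ^ k)" by (auto intro!: injI dest: frob_inj)
  then have "surj (\<lambda>x::'a. x ^ 2 ^ k)" by (rule finite_UNIV_inj_surj[rotated]) simp
  then show ?thesis by (metis surjD)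
qed

lemma frob_m: "(x::'a) ^ 2 ^ m = x"
proof (cases "x = 0")
  case False
  have "Suc (2 ^ m - 1) = 2 ^ m" by simp
  then have "x ^ 2 ^ m = x * x ^ (2 ^ m - 1)" by (metis power_Suc)
  with power_card_minus_1_eq_1[OF False] show ?thesis by (simp add: card_field)
qed simp

text \<open>The image of \<open>x \<mapsto> x\<^sup>2 + x\<close> is an additive subgroup of index two, so its sign function is a character.\<close>

definition artin_schreier :: "'a set" where
  "artin_schreier = range (\<lambda>x. x ^ 2 + x)"

definition chi :: "'a \<Rightarrow> int" where
  "chi x = (if x \<in> artin_schreier then 1 else - 1)"

lemma artin_schreier_add: "x \<in> artin_schreier \<Longrightarrow> y \<in> artin_schreier \<Longrightarrow> x + y \<in> artin_schreier"
proof -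
  assume "x \<in> artin_schreier" "y \<in> artin_schreier"
  then obtain u v where "x = u ^ 2 + u" "y = v ^ 2 + v" by (auto simp: artin_schreier_def)
  then have "x + y = (u + v) ^ 2 + (u + v)" by (simp add: power2_add ac_simps)
  then show ?thesis by (auto simp: artin_schreier_def)
qed

lemma card_artin_schreier: "CARD('a) = 2 * card artin_schreier"
  unfolding artin_schreier_def
proof (rule card_fibres_eq)
  fix y :: 'a assume "y \<in> range (\<lambda>x. x ^ 2 + x)"
  then obtain z where z: "y = z ^ 2 + z" by auto
  have "x ^ 2 + x = y \<longleftrightarrow> x = z \<or> x = z + 1" for x
  proof -
    have "x ^ 2 + x = y \<longleftrightarrow> (x + z) * (x + (z + 1)) = 0"
      unfolding z add_eq_0_iff_eq[symmetric, of "x ^ 2 + x"]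
      by (simp add: power2_eq_square algebra_simps)
    then show ?thesis by (simp add: add_eq_0_iff_eq)
  qed
  then have "{x \<in> UNIV. x ^ 2 + x = y} = {z, z + 1}" by auto
  then show "card {x \<in> UNIV. x ^ 2 + x = y} = 2" by simp
qed simp

lemma chi_nontrivial: "\<exists>x. chi x \<noteq> 1"
proof -
  have "artin_schreier \<noteq> UNIV"
  proof
    assume "artin_schreier = UNIV"
    then have "CARD('a) = 0" using card_artin_schreier by simp
    then show False by simp
  qed
  then show ?thesis by (auto simp: chi_def)
qed

lemma artin_schreier_add_iff:
  assumes "x \<in> artin_schreier"
  shows "x + y \<in> artin_schreier \<longleftrightarrow> y \<in> artin_schreier"
  using artin_schreier_add[OF assms, of y] artin_schreier_add[OF assms, of "x + y"] by auto

text \<open>The subgroup and its coset by \<open>x\<close> are disjoint halves of the field, so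
  \<open>y\<close> lies in that coset.\<close>

lemma artin_schreier_add_nonmembers:
  assumes x: "x \<notin> artin_schreier" and y: "y \<notin> artin_schreier"
  shows "x + y \<in> artin_schreier"
proof -
  define A where "A = (+) x ` artin_schreier"
  have "A \<inter> artin_schreier = {}"
    using x artin_schreier_add_iff by (auto simp: A_def add.commute[of x])
  moreover have "card A = card artin_schreier" unfolding A_def by (simp add: card_image)
  ultimately have "card (A \<union> artin_schreier) = CARD('a)"
    by (subst card_Un_disjoint) (auto simp: card_artin_schreier)
  then have "A \<union> artin_schreier = UNIV" by (intro card_subset_eq) auto
  then obtain a where "a \<in> artin_schreier" "y = x + a" using y by (auto simp: A_def)
  then show ?thesis by simp
qed

lemma chi_add: "chi (x + y) = chi x * chi y"
proof (cases "x \<in> artin_schreier")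
  case True
  then show ?thesis by (simp add: chi_def artin_schreier_add_iff)
next
  case x: False
  show ?thesis
  proof (cases "y \<in> artin_schreier")
    case True
    with x show ?thesis by (simp add: chi_def artin_schreier_add_iff add.commute[of x])
  next
    case False
    with x show ?thesis by (simp add: chi_def artin_schreier_add_nonmembers)
  qed
qed

lemma chi_0 [simp]: "chi 0 = 1"
  by (auto simp: chi_def artin_schreier_def intro!: image_eqI[of _ _ 0])

text \<open>For \<open>a \<noteq> 0\<close> the products \<open>c * a\<close> fill the field. This
  turns equations between character values into equations in the field.\<close>

lemma chi_trivial_on_line:
  assumes "\<And>c. chi (c * a) = 1"
  shows "a = 0"
proof (rule ccontr)
  assume "a \<noteq> 0"
  have "chi x = 1" for x using assms[of "x / a"] \<open>a \<noteq> 0\<close> by simp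
  then show False using chi_nontrivial by blast
qed

end

subsection \<open>Diagonalisation by character sums\<close>

text \<open>This is \<open>M(u, v)\<close> of the overview; the entries of the quadruple are its
  values on pairs of standard basis vectors.\<close>

definition twisted_form :: "nat \<Rightarrow> 'a::field quadruple \<Rightarrow> 'a \<times> 'a \<Rightarrow> 'a \<times> 'a \<Rightarrow> 'a" where
  "twisted_form s = (\<lambda>(p1, p2, p3, p4) (x, y) (z, w).
     p1 * x ^ 2 ^ s * z + p2 * x ^ 2 ^ s * w + p3 * y ^ 2 ^ s * z + p4 * y ^ 2 ^ s * w)"

text \<open>The condition on \<open>p1\<close> excludes zeros on the line \<open>y = 0\<close>;
  elsewhere dehomogenising by \<open>y\<close> turns zeros of the form into roots of the
  polynomial.\<close>

lemma legitimate_iff_anisotropic: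
  "legitimate s t \<longleftrightarrow> (\<forall>v. twisted_form s t v v = 0 \<longrightarrow> v = 0)"
proof (cases t)
  case (fields p1 p2 p3 p4)
  define P where "P x = p1 * x ^ (2 ^ s + 1) + p2 * x ^ 2 ^ s + p3 * x + p4" for x
  have leg: "legitimate s t \<longleftrightarrow> p1 \<noteq> 0 \<and> (\<forall>x. P x \<noteq> 0)"
    by (simp add: fields legitimate_def P_def)
  have horizontal: "twisted_form s t (x, 0) (x, 0) = p1 * (x ^ 2 ^ s * x)" for x
    by (simp add: fields twisted_form_def zero_power)
  have affine: "twisted_form s t (x, y) (x, y) = y ^ (2 ^ s + 1) * P (x / y)" if "y \<noteq> 0" for x y
    using that by (simp add: fields twisted_form_def P_def power_divide field_simps)
  show ?thesis
  proof
    assume l: "legitimate s t"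
    show "\<forall>v. twisted_form s t v v = 0 \<longrightarrow> v = 0"
    proof (intro allI impI)
      fix v assume v: "twisted_form s t v v = 0"
      obtain x y where xy: "v = (x, y)" by (cases v)
      have "y = 0" using v l affine[of y x] by (auto simp: xy leg)
      then show "v = 0" using v l horizontal[of x] by (auto simp: xy leg zero_prod_def)
    qed
  next
    assume a: "\<forall>v. twisted_form s t v v = 0 \<longrightarrow> v = 0"
    have "p1 \<noteq> 0" using a[rule_format, of "(1, 0)"] horizontal[of 1] by (auto simp: zero_prod_def)
    moreover have "P x \<noteq> 0" for x
      using a[rule_format, of "(x, 1)"] affine[of 1 x] by (auto simp: zero_prod_def)
    ultimately show "legitimate s t" by (simp add: leg)
  qed
qed

lemma twisted_form_add_right:
  "twisted_form s t u (v + w) = twisted_form s t u v + twisted_form s t u w"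
  by (cases t; cases u; cases v; cases w) (simp add: twisted_form_def algebra_simps)

lemma twisted_form_scale_right: "twisted_form s t u (c * x, c * y) = c * twisted_form s t u (x, y)"
  by (cases t; cases u) (simp add: twisted_form_def algebra_simps)

lemma twisted_form_scale_left:
  "twisted_form s t (c * x, c * y) v = c ^ 2 ^ s * twisted_form s t (x, y) v"
  by (cases t; cases v) (simp add: twisted_form_def power_mult_distrib algebra_simps)

lemma sum_split_0:
  fixes f :: "'a::{field,finite} \<Rightarrow> 'b::comm_monoid_add"
  shows "(\<Sum>x\<in>UNIV. f x) = f 0 + (\<Sum>x\<in>UNIV - {0}. f x)"
  by (rule sum.remove) auto

section \<open>Character sums attached to a quadruple\<close>

context binary_field
begin

lemma twisted_form_add_left:
  "twisted_form s t (u + v) w = twisted_form s t u w + twisted_form s t v (w :: 'a \<times> 'a)"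
  by (cases t; cases u; cases v; cases w) (simp add: twisted_form_def frob_add algebra_simps)

definition form_sum :: "nat \<Rightarrow> 'a quadruple \<Rightarrow> 'a \<Rightarrow> int" where
  "form_sum s t \<kappa> = (\<Sum>v\<in>UNIV. chi (\<kappa> * twisted_form s t v v))"

text \<open>The summand depends only on \<open>x ^ k\<close>, and all fibres of this map on the
  units have the size of its kernel.\<close>

lemma dvd_sum_chi_power:
  "int (card {x::'a. x ^ k = 1 \<and> x \<noteq> 0}) dvd (\<Sum>x\<in>UNIV - {0}. chi (a * x ^ k))"
  using sum_fibres_eq[of "UNIV - {0}" "\<lambda>x::'a. x ^ k" "card {x::'a. x ^ k = 1 \<and> x \<noteq> 0}" "\<lambda>y. chi (a * y)"]
    card_power_fibre[where 'a='a, of _ k] by (simp add: unit_powers_def)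

text \<open>The zero vector contributes \<open>1\<close>. The other vectors split into punctured
  lines spanned by \<open>(0, 1)\<close> and by the \<open>(1, y)\<close>; since
  \<open>f(x v) = x ^ (\<sigma> + 1) f(v)\<close>, each line contributes a power sum
  \<open>T a\<close>.\<close>

lemma form_sum_cong_1:
  "int (card {x::'a. x ^ (2 ^ s + 1) = 1 \<and> x \<noteq> 0}) dvd form_sum s t \<kappa> - 1"
proof (cases t)
  case (fields p1 p2 p3 p4)
  define g where "g x y = chi (\<kappa> * twisted_form s t (x, y) (x, y))" for x y
  define T where "T a = (\<Sum>x\<in>UNIV - {0}. chi (a * x ^ (2 ^ s + 1)))" for a
  have "form_sum s t \<kappa> = (\<Sum>x\<in>UNIV. \<Sum>y\<in>UNIV. g x y)"
    by (simp add: form_sum_def g_def sum.cartesian_product case_prod_beta)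
  also have "\<dots> = (\<Sum>y\<in>UNIV. g 0 y) + (\<Sum>x\<in>UNIV - {0}. \<Sum>y\<in>UNIV. g x y)"
    by (rule sum_split_0)
  also have "(\<Sum>y\<in>UNIV. g 0 y) = 1 + T (\<kappa> * p4)"
    by (subst sum_split_0) (simp add: g_def T_def fields twisted_form_def zero_power mult_ac)
  also have "(\<Sum>x\<in>UNIV - {0}. \<Sum>y\<in>UNIV. g x y)
      = (\<Sum>x\<in>UNIV - {0}. \<Sum>y\<in>UNIV. chi (\<kappa> * twisted_form s t (1, y) (1, y) * x ^ (2 ^ s + 1)))"
  proof (rule sum.cong[OF refl])
    fix x :: 'a assume "x \<in> UNIV - {0}"
    then have "(\<Sum>y\<in>UNIV. g x y) = (\<Sum>y\<in>UNIV. g x (x * y))"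
      by (intro sum.reindex_bij_witness[of _ "\<lambda>y. x * y" "\<lambda>y. y / x"]) auto
    moreover have "g x (x * y) = chi (\<kappa> * twisted_form s t (1, y) (1, y) * x ^ (2 ^ s + 1))" for y
      using twisted_form_scale_left[of s t x 1 y] twisted_form_scale_right[of s t _ x 1 y]
      by (simp add: g_def mult_ac)
    ultimately show "(\<Sum>y\<in>UNIV. g x y)
        = (\<Sum>y\<in>UNIV. chi (\<kappa> * twisted_form s t (1, y) (1, y) * x ^ (2 ^ s + 1)))" by simp
  qed
  also have "\<dots> = (\<Sum>y\<in>UNIV. T (\<kappa> * twisted_form s t (1, y) (1, y)))"
    unfolding T_def by (rule sum.swap)
  finally have "form_sum s t \<kappa> - 1
      = T (\<kappa> * p4) + (\<Sum>y\<in>UNIV. T (\<kappa> * twisted_form s t (1, y) (1, y)))" by simp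
  moreover have "int (card {x::'a. x ^ (2 ^ s + 1) = 1 \<and> x \<noteq> 0}) dvd T a" for a
    unfolding T_def by (rule dvd_sum_chi_power)
  ultimately show ?thesis by (auto intro!: dvd_add dvd_sum)
qed

text \<open>Expanding the square with \<open>v = u + w\<close> leaves, for each \<open>w\<close>,
  the sum over \<open>u\<close> of a character. It is nontrivial unless \<open>w = 0\<close>, so
  only the term \<open>w = 0\<close> survives.\<close>

lemma form_sum_squared:
  assumes "\<And>w. w \<noteq> 0 \<Longrightarrow> \<exists>u. chi (\<kappa> * (twisted_form s t u w + twisted_form s t w u)) \<noteq> 1"
  shows "(form_sum s t \<kappa>)\<^sup>2 = (2 ^ m)\<^sup>2"
proof -
  define \<psi> where "\<psi> v = chi (\<kappa> * twisted_form s t v v)" for v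
  define \<phi> where "\<phi> u w = chi (\<kappa> * (twisted_form s t u w + twisted_form s t w u))" for u w
  \<comment> \<open>The two copies of \<open>f(u)\<close> cancel in characteristic two, leaving
    \<open>f(w)\<close> and the polar form.\<close>
  have shift: "\<psi> u * \<psi> (u + w) = \<psi> w * \<phi> u w" for u w
  proof -
    have "\<psi> u * \<psi> (u + w) = chi (\<kappa> * twisted_form s t u u + \<kappa> * twisted_form s t (u + w) (u + w))"
      by (simp add: \<psi>_def chi_add)
    also have "\<kappa> * twisted_form s t u u + \<kappa> * twisted_form s t (u + w) (u + w)
        = \<kappa> * twisted_form s t w w + \<kappa> * (twisted_form s t u w + twisted_form s t w u)"
      by (simp add: twisted_form_add_left twisted_form_add_right algebra_simps)
    finally show ?thesis by (simp add: chi_add \<psi>_def \<phi>_def)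
  qed
  have "(\<Sum>u\<in>UNIV. \<phi> u w) = 0" if "w \<noteq> 0" for w
  proof -
    obtain u where "\<phi> u w \<noteq> 1" using assms[OF \<open>w \<noteq> 0\<close>] by (auto simp: \<phi>_def)
    then show ?thesis
      by (rule sum_character_eq_0[rotated])
        (simp add: \<phi>_def twisted_form_add_left twisted_form_add_right algebra_simps flip: chi_add)
  qed
  moreover have "\<phi> u 0 = 1" for u
    using twisted_form_add_left[of s t 0 0 u] twisted_form_add_right[of s t u 0 0]
    by (simp add: \<phi>_def)
  ultimately have inner: "(\<Sum>u\<in>UNIV. \<phi> u w) = (if w = 0 then 2 ^ m * 2 ^ m else 0)" for w
    by (simp add: card_field flip: UNIV_Times_UNIV)
  have "\<psi> 0 = 1" using twisted_form_add_left[of s t 0 0 0] by (simp add: \<psi>_def)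
  have "(form_sum s t \<kappa>)\<^sup>2 = (\<Sum>u\<in>UNIV. \<Sum>v\<in>UNIV. \<psi> u * \<psi> v)"
    by (simp add: form_sum_def \<psi>_def power2_eq_square sum_product)
  also have "\<dots> = (\<Sum>u\<in>UNIV. \<Sum>w\<in>UNIV. \<psi> u * \<psi> (u + w))"
  proof (rule sum.cong[OF refl])
    fix u :: "'a \<times> 'a"
    show "(\<Sum>v\<in>UNIV. \<psi> u * \<psi> v) = (\<Sum>w\<in>UNIV. \<psi> u * \<psi> (u + w))"
      by (rule sum.reindex_bij_witness[of _ "\<lambda>w. u + w" "\<lambda>v. v - u"]) (auto simp: algebra_simps)
  qed
  also have "\<dots> = (\<Sum>w\<in>UNIV. \<Sum>u\<in>UNIV. \<psi> w * \<phi> u w)"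
    by (simp add: shift) (rule sum.swap)
  also have "\<dots> = (\<Sum>w\<in>UNIV. \<psi> w * (if w = 0 then 2 ^ m * 2 ^ m else 0))"
    by (simp add: inner flip: sum_distrib_left)
  also have "\<dots> = (2 ^ m)\<^sup>2"
    using \<open>\<psi> 0 = 1\<close> by (simp add: power2_eq_square if_distrib[of "(*) _"] cong: if_cong)
  finally show ?thesis .
qed

text \<open>After exchanging the sums, the sum over \<open>\<kappa>\<close> vanishes unless
  \<open>f(v) = 0\<close>, which by anisotropy means \<open>v = 0\<close>.\<close>

lemma sum_form_sum:
  assumes "legitimate s t"
  shows "(\<Sum>\<kappa>\<in>UNIV. form_sum s t \<kappa>) = 2 ^ m"
proof -
  have "(\<Sum>\<kappa>\<in>UNIV. form_sum s t \<kappa>)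
      = (\<Sum>v\<in>UNIV. \<Sum>\<kappa>\<in>UNIV. chi (\<kappa> * twisted_form s t v v))"
    unfolding form_sum_def by (rule sum.swap)
  also have "\<dots> = (\<Sum>v\<in>(UNIV :: ('a \<times> 'a) set). if v = 0 then 2 ^ m else 0)"
  proof (rule sum.cong[OF refl])
    fix v :: "'a \<times> 'a"
    show "(\<Sum>\<kappa>\<in>UNIV. chi (\<kappa> * twisted_form s t v v)) = (if v = 0 then 2 ^ m else 0)"
    proof (cases "v = 0")
      case True
      have "twisted_form s t 0 0 = 0" using twisted_form_add_left[of s t 0 0 0] by simp
      with True show ?thesis by (simp add: card_field)
    next
      case False
      then have "twisted_form s t v v \<noteq> 0" using assms unfolding legitimate_iff_anisotropic by blast
      then obtain c where "chi (c * twisted_form s t v v) \<noteq> 1"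
        using chi_trivial_on_line by blast
      then have "(\<Sum>\<kappa>\<in>UNIV. chi (\<kappa> * twisted_form s t v v)) = 0"
        by (rule sum_character_eq_0[rotated]) (simp add: chi_add distrib_right)
      with False show ?thesis by simp
    qed
  qed
  also have "\<dots> = 2 ^ m" by simp
  finally show ?thesis .
qed

lemma ex_radical_vector:
  assumes leg: "legitimate s t"
    and R_def: "R = card {x::'a. x ^ (2 ^ s + 1) = 1}" and "R dvd 2 ^ m - 1" and "R > 2"
  shows "\<exists>\<kappa> w. \<kappa> \<noteq> 0 \<and> w \<noteq> 0 \<and>
    (\<forall>u. chi (\<kappa> * (twisted_form s t u w + twisted_form s t w u)) = 1)"
proof (rule ccontr)
  assume contra: "\<not> ?thesis"
  have R: "R = card {x::'a. x ^ (2 ^ s + 1) = 1 \<and> x \<noteq> 0}"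
    unfolding R_def by (intro arg_cong[where f = card]) auto
  have "int R dvd 2 ^ m - 1"
    using \<open>R dvd 2 ^ m - 1\<close> by (simp add: of_nat_diff flip: int_dvd_int_iff)
  have S: "form_sum s t \<kappa> = 2 ^ m" if "\<kappa> \<noteq> 0" for \<kappa>
  proof (rule ccontr)
    assume ne: "form_sum s t \<kappa> \<noteq> 2 ^ m"
    have "(form_sum s t \<kappa>)\<^sup>2 = (2 ^ m)\<^sup>2"
      by (rule form_sum_squared) (use that contra \<open>\<kappa> \<noteq> 0\<close> in blast)
    with ne have "form_sum s t \<kappa> = - (2 ^ m)" by (simp add: power2_eq_iff)
    with form_sum_cong_1[of s t \<kappa>] have "int R dvd - (2 ^ m) - 1" by (simp add: R)
    from dvd_add[OF this \<open>int R dvd 2 ^ m - 1\<close>] have "int R dvd 2" by simp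
    then show False using \<open>R > 2\<close> by (auto dest: zdvd_imp_le)
  qed
  \<comment> \<open>With \<open>S(0) = 4^m\<close>, the total \<open>2^m (2 * 2^m - 1)\<close>
    equals \<open>2^m\<close> only for a field with one element.\<close>
  have "form_sum s t 0 = 2 ^ m * 2 ^ m"
    by (simp add: form_sum_def card_field flip: UNIV_Times_UNIV)
  then have "(\<Sum>\<kappa>\<in>UNIV. form_sum s t \<kappa>) = 2 ^ m * 2 ^ m + (\<Sum>\<kappa>\<in>UNIV - {0::'a}. 2 ^ m)"
    by (subst sum_split_0) (simp add: S)
  also have "\<dots> = 2 ^ m * (2 * 2 ^ m - 1)"
    by (simp only: sum_constant card_units card_field) (simp add: of_nat_diff algebra_simps)
  finally have "2 ^ m * (2 * 2 ^ m - 1) = (2 ^ m :: int)" using sum_form_sum[OF leg] by simp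
  then have "2 ^ m * (2 * 2 ^ m - 1) = 2 ^ m * (1::int)" by simp
  then have "2 * 2 ^ m - 1 = (1::int)" by (subst (asm) mult_left_cancel) simp_all
  then have "int CARD('a) = 1" by (simp add: card_field)
  then have "CARD('a) = 1" by simp
  moreover have "card {0, 1::'a} \<le> CARD('a)" by (intro card_mono) auto
  ultimately show False by simp
qed

lemma ex_orthogonal_basis:
  assumes leg: "legitimate s t"
    and R: "card {x::'a. x ^ (2 ^ s + 1) = 1} dvd 2 ^ m - 1" "card {x::'a. x ^ (2 ^ s + 1) = 1} > 2"
  obtains a b c d :: 'a where "a * d + b * c \<noteq> 0"
    "twisted_form s t (a, c) (b, d) = 0" "twisted_form s t (b, d) (a, c) = 0"
proof -
  obtain \<kappa> w where "\<kappa> \<noteq> 0" "w \<noteq> 0"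
    and rad: "\<And>u. chi (\<kappa> * (twisted_form s t u w + twisted_form s t w u)) = 1"
    using ex_radical_vector[OF leg refl R] by blast
  obtain p1 p2 p3 p4 where t: "t = (p1, p2, p3, p4)" by (cases t)
  obtain a c where w: "w = (a, c)" by (cases w)
  \<comment> \<open>\<open>(b, d)\<close> spans the kernel of the linear form
    \<open>M(w, _)\<close>: its coordinates are the two coefficients exchanged. With this choice the
    determinant of the basis is \<open>f(w)\<close>.\<close>
  define b where "b = p2 * a ^ 2 ^ s + p4 * c ^ 2 ^ s"
  define d where "d = p1 * a ^ 2 ^ s + p3 * c ^ 2 ^ s"
  have "a * d + b * c = twisted_form s t w w"
    by (simp add: t w b_def d_def twisted_form_def algebra_simps)
  then have "a * d + b * c \<noteq> 0"
    using leg[unfolded legitimate_iff_anisotropic, rule_format, of w] \<open>w \<noteq> 0\<close> by metis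
  moreover have right: "twisted_form s t (a, c) (b, d) = 0"
    by (simp add: t b_def d_def twisted_form_def algebra_simps)
  \<comment> \<open>The radical controls only values of \<open>chi\<close>. Scaling
    \<open>(b, d)\<close> by \<open>y\<close> scales \<open>M((b, d), w)\<close> by
    \<open>y ^ \<sigma>\<close>, an arbitrary field element, while the other term stays
    zero.\<close>
  moreover have "chi (x * (\<kappa> * twisted_form s t (b, d) (a, c))) = 1" for x
  proof -
    obtain y where y: "x = y ^ 2 ^ s" using frob_surj by blast
    have "x * (\<kappa> * twisted_form s t (b, d) (a, c)) = \<kappa> *
        (twisted_form s t (y * b, y * d) (a, c) + twisted_form s t (a, c) (y * b, y * d))"
      unfolding twisted_form_scale_left twisted_form_scale_right right y by (simp add: mult_ac)
    then show ?thesis using rad[of "(y * b, y * d)"] by (simp only: w)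
  qed
  then have "twisted_form s t (b, d) (a, c) = 0" using chi_trivial_on_line \<open>\<kappa> \<noteq> 0\<close> by fastforce
  ultimately show ?thesis using that by blast
qed

end

subsection \<open>The group action and isotopisms\<close>

definition mat_apply :: "'a::field ^ 2 ^ 2 \<Rightarrow> 'a \<times> 'a \<Rightarrow> 'a \<times> 'a" where
  "mat_apply A = (\<lambda>(x, y). (A $ 1 $ 1 * x + A $ 1 $ 2 * y, A $ 2 $ 1 * x + A $ 2 $ 2 * y))"

lemma mat_apply_mult: "mat_apply (A ** A') v = mat_apply A (mat_apply A' v)"
  by (cases v) (simp add: mat_apply_def matrix_matrix_mult_def sum_2 algebra_simps)

lemma mat_apply_1: "mat_apply (mat 1) v = v"
  by (cases v) (simp add: mat_apply_def mat_def)

lemma mat_apply_add: "mat_apply A (u + v) = mat_apply A u + mat_apply A v"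
  by (cases u; cases v) (simp add: mat_apply_def algebra_simps)

lemma bij_mat_apply:
  assumes "invertible A"
  shows "bij (mat_apply A)"
proof -
  obtain A' where "A ** A' = mat 1" "A' ** A = mat 1" using assms by (auto simp: invertible_def)
  then show ?thesis
    by (intro o_bij[of "mat_apply A'"]) (auto simp: mat_apply_1 simp flip: mat_apply_mult)
qed

text \<open>Identities between group actions on quadruples can thus be checked on forms.\<close>

lemma quadruple_eqI:
  assumes "\<And>u v. twisted_form s t u v = twisted_form s t' u v"
  shows "t = t'"
proof -
  have "t = (twisted_form s t (1, 0) (1, 0), twisted_form s t (1, 0) (0, 1),
      twisted_form s t (0, 1) (1, 0), twisted_form s t (0, 1) (0, 1))" for t :: "'a::field quadruple"
    by (cases t) (simp add: twisted_form_def zero_power)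
  then show ?thesis using assms by metis
qed

lemma twisted_form_scalar_act: "twisted_form s (scalar_act c t) u v = c * twisted_form s t u v"
  by (cases t; cases u; cases v) (simp add: scalar_act_def twisted_form_def algebra_simps)

text \<open>The transformation formulas compute the Gram matrix of the form in the basis given by
  the columns of \<open>A\<close>.\<close>

lemma matrix_act_eq_twisted_form:
  fixes A :: "'a::field ^ 2 ^ 2"
  defines "x \<equiv> (A $ 1 $ 1, A $ 2 $ 1)" and "y \<equiv> (A $ 1 $ 2, A $ 2 $ 2)"
  shows "matrix_act s A t =
    (twisted_form s t x x, twisted_form s t x y, twisted_form s t y x, twisted_form s t y y)"
  by (cases t) (simp add: x_def y_def matrix_act_def twisted_form_def Let_def algebra_simps)

lemma B_eq_twisted_form:
  "B s l t u v = (twisted_form s t v u + l * twisted_form s t u v, fst u * snd v + snd u * fst v)"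
  by (cases t; cases u; cases v) (simp add: B_def Let_def twisted_form_def algebra_simps)

lemma ex_matrix_2: "\<exists>A :: 'a::field ^ 2 ^ 2. A $ 1 $ 1 = a \<and> A $ 1 $ 2 = b \<and> A $ 2 $ 1 = c \<and> A $ 2 $ 2 = d"
  by (intro exI[of _ "vector [vector [a, b], vector [c, d]]"]) simp

lemma proportional_if_det_eq_0:
  fixes a b c d :: "'a::field"
  assumes "a * d = b * c" and "(a, b) \<noteq> 0" and "(c, d) \<noteq> 0"
  obtains k where "k \<noteq> 0" "c = k * a" "d = k * b"
proof (cases "a = 0")
  case True
  then have "b \<noteq> 0" "c = 0" using assms by (auto simp: zero_prod_def)
  then show ?thesis using that[of "d / b"] assms True by (auto simp: zero_prod_def)
next
  case False
  then have "d = c / a * b" using assms(1) by (simp add: field_simps)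
  moreover from this have "c \<noteq> 0" using assms(3) by (auto simp: zero_prod_def)
  ultimately show ?thesis using that[of "c / a"] False by auto
qed

section \<open>Orbits, absence of zero divisors and isotopisms\<close>

context binary_field
begin

lemma twisted_form_matrix_act:
  fixes A :: "'a ^ 2 ^ 2"
  shows "twisted_form s (matrix_act s A t) u v = twisted_form s t (mat_apply A u) (mat_apply A v)"
  by (cases t; cases u; cases v)
    (simp add: matrix_act_eq_twisted_form twisted_form_def mat_apply_def frob_add power_mult_distrib
      algebra_simps)

lemma twisted_form_G1_act:
  fixes A :: "'a ^ 2 ^ 2"
  shows "twisted_form s (G1_act s (A, c) t) u v
    = c * twisted_form s t (mat_apply A u) (mat_apply A v)"
  by (simp add: G1_act_def twisted_form_scalar_act twisted_form_matrix_act)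

lemma G1_act_mult:
  fixes A :: "'a ^ 2 ^ 2"
  shows "G1_act s (A', c') (G1_act s (A, c) t) = G1_act s (A ** A', c' * c) t"
  by (rule quadruple_eqI[of s]) (simp add: twisted_form_G1_act mat_apply_mult mult_ac)

lemma G1_act_1: "G1_act s (mat 1 :: 'a ^ 2 ^ 2, 1) t = t"
  by (rule quadruple_eqI[of s]) (simp add: twisted_form_G1_act mat_apply_1)

lemma mem_G1_orbit_iff:
  fixes t :: "'a quadruple"
  shows "t' \<in> G1_orbit s t \<longleftrightarrow> (\<exists>A c. invertible A \<and> c \<noteq> 0 \<and> t' = G1_act s (A, c) t)"
  by (auto simp: G1_orbit_def G1_def)

lemma G1_orbit_refl: "t \<in> G1_orbit s (t :: 'a quadruple)"
  unfolding mem_G1_orbit_iff by (intro exI[of _ "mat 1"] exI[of _ 1]) (simp add: G1_act_1 invertible_def)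

lemma G1_orbit_trans:
  fixes t :: "'a quadruple"
  assumes "t' \<in> G1_orbit s t" and "t'' \<in> G1_orbit s t'"
  shows "t'' \<in> G1_orbit s t"
  using assms unfolding mem_G1_orbit_iff
  by (metis G1_act_mult invertible_mult mult_eq_0_iff)

lemma G1_orbit_sym:
  fixes t :: "'a quadruple"
  assumes "t' \<in> G1_orbit s t"
  shows "t \<in> G1_orbit s t'"
proof -
  obtain A c where A: "invertible A" "c \<noteq> 0" "t' = G1_act s (A, c) t"
    using assms mem_G1_orbit_iff by blast
  obtain A' where A': "A ** A' = mat 1" "A' ** A = mat 1" using A by (auto simp: invertible_def)
  then have "t = G1_act s (A', inverse c) t'"
    using A by (simp add: G1_act_mult G1_act_1)
  moreover have "invertible A'" using A' by (auto simp: invertible_def)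
  ultimately show ?thesis using A mem_G1_orbit_iff inverse_nonzero_iff_nonzero by blast
qed

lemma G1_orbit_eq_iff:
  fixes t :: "'a quadruple"
  shows "G1_orbit s t = G1_orbit s t' \<longleftrightarrow> t' \<in> G1_orbit s t"
  using G1_orbit_refl G1_orbit_sym G1_orbit_trans by blast

lemma legitimate_G1_orbit:
  fixes t :: "'a quadruple"
  assumes "legitimate s t" and "t' \<in> G1_orbit s t"
  shows "legitimate s t'"
proof -
  obtain A c where A: "invertible A" "c \<noteq> 0" "t' = G1_act s (A, c) t"
    using assms(2) mem_G1_orbit_iff by blast
  have "v = 0" if "twisted_form s t' v v = 0" for v
  proof -
    have "twisted_form s t (mat_apply A v) (mat_apply A v) = 0"
      using that A by (simp add: twisted_form_G1_act)
    then have "mat_apply A v = 0"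
      using assms(1) unfolding legitimate_iff_anisotropic by blast
    moreover have "mat_apply A 0 = 0" by (simp add: mat_apply_def zero_prod_def)
    ultimately show ?thesis using bij_mat_apply[OF A(1)] by (metis bij_pointE)
  qed
  then show ?thesis by (simp add: legitimate_iff_anisotropic)
qed

text \<open>If the product is zero, the determinant in its second coordinate makes
  \<open>v = k u\<close>; the first coordinate is then \<open>(k ^ \<sigma> + l k) f(u)\<close>,
  which would force \<open>l = k ^ (\<sigma> - 1)\<close>.\<close>

lemma presemifield_B:
  fixes l :: 'a
  assumes "legitimate s t" and "l \<notin> sigma_powers s"
  shows "presemifield (B s l t)"
  unfolding presemifield_def
proof (intro conjI allI impI)
  show "B s l t x (y + z) = B s l t x y + B s l t x z"
    and "B s l t (x + y) z = B s l t x z + B s l t y z" for x y z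
    by (simp_all add: B_eq_twisted_form twisted_form_add_left twisted_form_add_right algebra_simps)
next
  fix u v assume uv: "B s l t u v = 0"
  show "u = 0 \<or> v = 0"
  proof (rule ccontr)
    assume "\<not> (u = 0 \<or> v = 0)"
    then have "u \<noteq> 0" "v \<noteq> 0" by auto
    obtain a b c d where abcd: "u = (a, b)" "v = (c, d)" by (cases u; cases v)
    have "a * d = b * c" using uv by (simp add: B_eq_twisted_form abcd zero_prod_def add_eq_0_iff_eq)
    then obtain k where "k \<noteq> 0" and k: "c = k * a" "d = k * b"
      using proportional_if_det_eq_0 \<open>u \<noteq> 0\<close> \<open>v \<noteq> 0\<close> abcd by metis
    have "twisted_form s t v u = k ^ 2 ^ s * twisted_form s t u u"
      unfolding abcd k by (rule twisted_form_scale_left)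
    moreover have "twisted_form s t u v = k * twisted_form s t u u"
      unfolding abcd k by (rule twisted_form_scale_right)
    ultimately have "(k ^ 2 ^ s + l * k) * twisted_form s t u u = 0"
      using uv by (simp add: B_eq_twisted_form zero_prod_def algebra_simps)
    moreover have "twisted_form s t u u \<noteq> 0"
      using assms(1) \<open>u \<noteq> 0\<close> unfolding legitimate_iff_anisotropic by blast
    ultimately have "k ^ 2 ^ s = l * k" by (simp add: add_eq_0_iff_eq)
    moreover have "k ^ 2 ^ s = k ^ (2 ^ s - 1) * k" by (rule power_minus_mult[symmetric]) simp
    ultimately have "l = k ^ (2 ^ s - 1)" using \<open>k \<noteq> 0\<close> by simp
    then show False using assms(2) \<open>k \<noteq> 0\<close> by (auto simp: sigma_powers_def)
  qed
qed

text \<open>The matrix acts on both factors. This multiplies the second coordinate by its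
  determinant, which \<open>\<beta>\<close> divides out, while \<open>c\<close> scales the first
  coordinate; \<open>l\<close> is unchanged.\<close>

lemma isotopic_B_G1_orbit:
  fixes t :: "'a quadruple"
  assumes "t' \<in> G1_orbit s t"
  shows "isotopic (B s l t) (B s l t')"
proof -
  obtain A c where A: "invertible A" "c \<noteq> 0" "t' = G1_act s (A, c) t"
    using assms mem_G1_orbit_iff by blast
  define D where "D = A $ 1 $ 1 * A $ 2 $ 2 + A $ 1 $ 2 * A $ 2 $ 1"
  have "D \<noteq> 0" using A(1) by (simp add: D_def invertible_det_nz det_2)
  define \<beta> where "\<beta> = (\<lambda>(x, y). (c * x, y / D))"
  have "bij \<beta>"
    by (rule o_bij[of "\<lambda>(x, y). (x / c, D * y)"]) (use \<open>c \<noteq> 0\<close> \<open>D \<noteq> 0\<close> in \<open>auto simp: \<beta>_def fun_eq_iff\<close>)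
  moreover have "additive \<beta>"
    by (rule additive.intro) (auto simp: \<beta>_def algebra_simps add_divide_distrib)
  moreover have "additive (mat_apply A)" by (rule additive.intro) (rule mat_apply_add)
  moreover have "bij (mat_apply A)" using bij_mat_apply A(1) .
  moreover have "\<beta> (B s l t (mat_apply A u) (mat_apply A v)) = B s l t' u v" for u v
  proof -
    have "fst (mat_apply A u) * snd (mat_apply A v) + snd (mat_apply A u) * fst (mat_apply A v)
        = D * (fst u * snd v + snd u * fst v)"
      by (cases u; cases v) (simp add: mat_apply_def D_def algebra_simps)
    moreover have "c * (x + l * y) = c * x + l * (c * y)" for x y
      by (simp add: algebra_simps)
    ultimately show ?thesis using \<open>D \<noteq> 0\<close>
      by (simp add: B_eq_twisted_form A(3) twisted_form_G1_act \<beta>_def)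
  qed
  ultimately show ?thesis unfolding isotopic_def by blast
qed

lemma ex_diagonal_in_G1_orbit:
  fixes t :: "'a quadruple"
  assumes leg: "legitimate s t"
    and R: "card {x::'a. x ^ (2 ^ s + 1) = 1} dvd 2 ^ m - 1" "card {x::'a. x ^ (2 ^ s + 1) = 1} > 2"
  shows "\<exists>p. (1, 0, 0, p) \<in> G1_orbit s t"
proof -
  obtain a b c d :: 'a where det: "a * d + b * c \<noteq> 0"
    and orth: "twisted_form s t (a, c) (b, d) = 0" "twisted_form s t (b, d) (a, c) = 0"
    by (rule ex_orthogonal_basis[OF leg R])
  obtain A :: "'a ^ 2 ^ 2" where A: "A $ 1 $ 1 = a" "A $ 1 $ 2 = b" "A $ 2 $ 1 = c" "A $ 2 $ 2 = d"
    using ex_matrix_2[of a b c d] by blast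
  define f where "f = twisted_form s t (a, c) (a, c)"
  have "(a, c) \<noteq> 0" using det by (auto simp: zero_prod_def)
  then have "f \<noteq> 0" using leg unfolding legitimate_iff_anisotropic f_def by blast
  have "invertible A" using det by (simp add: invertible_det_nz det_2 A)
  moreover have "(1, 0, 0, twisted_form s t (b, d) (b, d) / f) = G1_act s (A, inverse f) t"
    using \<open>f \<noteq> 0\<close>
    by (simp add: G1_act_def scalar_act_def matrix_act_eq_twisted_form A orth field_simps flip: f_def)
  ultimately show ?thesis using \<open>f \<noteq> 0\<close> mem_G1_orbit_iff inverse_nonzero_iff_nonzero by blast
qed

section \<open>Orbits of diagonal quadruples\<close>

lemma legitimate_diagonal_iff:
  "legitimate s (1, 0, 0, p :: 'a) \<longleftrightarrow> p \<noteq> 0 \<and> p \<notin> unit_powers (2 ^ s + 1)"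
proof -
  have "(\<exists>x::'a. x ^ (2 ^ s + 1) = p) \<longleftrightarrow> p = 0 \<or> p \<in> unit_powers (2 ^ s + 1)"
  proof
    assume "\<exists>x::'a. x ^ (2 ^ s + 1) = p"
    then obtain x where x: "x ^ (2 ^ s + 1) = p" by blast
    then show "p = 0 \<or> p \<in> unit_powers (2 ^ s + 1)"
      using power_in_unit_powers[of x "2 ^ s + 1"] by (cases "x = 0") auto
  next
    assume "p = 0 \<or> p \<in> unit_powers (2 ^ s + 1)"
    then show "\<exists>x::'a. x ^ (2 ^ s + 1) = p"
    proof
      assume "p = 0"
      then have "0 ^ (2 ^ s + 1) = p" by simp
      then show ?thesis by blast
    qed (auto simp: unit_powers_def)
  qed
  then show ?thesis by (auto simp: legitimate_def add_eq_0_iff_eq)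
qed

text \<open>The square root \<open>j\<close> of \<open>k\<close> is also fixed by
  \<open>\<sigma>\<close>, hence \<open>k = j * j = j ^ \<sigma> * j\<close>.\<close>

lemma fixed_in_unit_powers:
  fixes k :: 'a
  assumes "k ^ 2 ^ s = k" and "k \<noteq> 0"
  shows "k \<in> unit_powers (2 ^ s + 1)"
proof -
  obtain j where j: "k = j ^ 2" using frob_surj[of k 1] by auto
  have "(j ^ 2 ^ s) ^ 2 ^ 1 = j ^ 2 ^ 1"
    using assms(1) unfolding j by (simp add: mult.commute flip: power_mult)
  then have "j ^ 2 ^ s = j" by (rule frob_inj)
  then have "k = j ^ (2 ^ s + 1)" by (simp add: j power2_eq_square)
  moreover have "j \<noteq> 0" using j assms(2) by auto
  ultimately show ?thesis by (metis power_in_unit_powers)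
qed

text \<open>The vanishing middle entries force the matrix to be diagonal, giving
  \<open>p' / p\<close>, or antidiagonal, giving \<open>p' * p\<close>, or to have no zero entry,
  which contradicts the choice of \<open>p\<close>.\<close>

lemma diagonal_mem_G1_orbit_imp:
  fixes p p' :: 'a
  assumes orbit: "(1, 0, 0, p') \<in> G1_orbit s (1, 0, 0, p)"
    and p: "p \<noteq> 0" "p \<notin> unit_powers (2 ^ s + 1)"
  shows "p' / p \<in> unit_powers (2 ^ s + 1) \<or> p' * p \<in> unit_powers (2 ^ s + 1)"
proof -
  obtain A c where A: "invertible A" "c \<noteq> 0" "(1, 0, 0, p') = G1_act s (A, c) (1, 0, 0, p)"
    using orbit mem_G1_orbit_iff by blast
  define \<alpha> \<beta> \<gamma> \<delta> where ABCD: "\<alpha> = A $ 1 $ 1" "\<beta> = A $ 1 $ 2" "\<gamma> = A $ 2 $ 1" "\<delta> = A $ 2 $ 2"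
  have det: "\<alpha> * \<delta> \<noteq> \<beta> * \<gamma>"
    using A(1) add_eq_0_iff_eq by (auto simp: invertible_det_nz det_2 ABCD)
  have e1: "c * (\<alpha> ^ (2 ^ s + 1) + \<gamma> ^ (2 ^ s + 1) * p) = 1"
    and e2: "\<alpha> ^ 2 ^ s * \<beta> = \<gamma> ^ 2 ^ s * \<delta> * p"
    and e3: "\<alpha> * \<beta> ^ 2 ^ s = \<gamma> * \<delta> ^ 2 ^ s * p"
    and e4: "p' = c * (\<beta> ^ (2 ^ s + 1) + \<delta> ^ (2 ^ s + 1) * p)"
    using A(2,3) by (simp_all add: G1_act_def scalar_act_def matrix_act_def Let_def add_eq_0_iff_eq
        flip: ABCD)
  consider "\<alpha> = 0" "\<delta> = 0" "\<beta> \<noteq> 0" "\<gamma> \<noteq> 0" | "\<beta> = 0" "\<gamma> = 0" "\<alpha> \<noteq> 0" "\<delta> \<noteq> 0"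
    | "\<alpha> \<noteq> 0" "\<beta> \<noteq> 0" "\<gamma> \<noteq> 0" "\<delta> \<noteq> 0"
  proof -
    have "\<alpha> = 0 \<Longrightarrow> \<delta> = 0" "\<gamma> = 0 \<Longrightarrow> \<beta> = 0"
      using det e2 p(1) by (auto simp: zero_power)
    moreover have "\<delta> = 0 \<Longrightarrow> \<alpha> = 0" "\<beta> = 0 \<Longrightarrow> \<gamma> = 0"
      using det e3 p(1) by (auto simp: zero_power)
    ultimately show thesis using det that by fastforce
  qed
  then show ?thesis
  proof cases
    case 1
    have "p = inverse (c * \<gamma> ^ (2 ^ s + 1))"
      using e1 1 by (intro inverse_unique[symmetric]) (simp add: mult_ac)
    then have "p' * p = (\<beta> / \<gamma>) ^ (2 ^ s + 1)"
      using e4 1 A(2) by (simp add: field_simps power_divide)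
    moreover have "\<beta> / \<gamma> \<noteq> 0" using 1 by simp
    ultimately show ?thesis by (metis power_in_unit_powers)
  next
    case 2
    have "c = inverse (\<alpha> ^ (2 ^ s + 1))"
      using e1 2 by (intro inverse_unique[symmetric]) (simp add: mult_ac)
    then have "p' / p = (\<delta> / \<alpha>) ^ (2 ^ s + 1)"
      using e4 2 p by (simp add: field_simps power_divide)
    moreover have "\<delta> / \<alpha> \<noteq> 0" using 2 by simp
    ultimately show ?thesis by (metis power_in_unit_powers)
  next
    case 3
    \<comment> \<open>The middle entries say \<open>p = x ^ \<sigma> * y = x * y ^ \<sigma>\<close>,
      so \<open>x / y\<close> is fixed by \<open>\<sigma>\<close>, and \<open>p\<close> becomes a
      product of two elements of \<open>H\<close>.\<close>
    define x y where "x = \<alpha> / \<gamma>" and "y = \<beta> / \<delta>"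
    have nz: "x \<noteq> 0" "y \<noteq> 0" using 3 by (auto simp: x_def y_def)
    have "p = x ^ 2 ^ s * y" using e2 3 by (simp add: x_def y_def field_simps power_divide)
    moreover have py: "p = x * y ^ 2 ^ s" using e3 3 by (simp add: x_def y_def field_simps power_divide)
    ultimately have "(x / y) ^ 2 ^ s = x / y" using nz by (simp add: field_simps power_divide)
    then have "x / y \<in> unit_powers (2 ^ s + 1)" using nz by (intro fixed_in_unit_powers) auto
    moreover have "p = x / y * y ^ (2 ^ s + 1)" using py nz by simp
    ultimately have "p \<in> unit_powers (2 ^ s + 1)"
      using unit_powers_mult power_in_unit_powers nz by metis
    then show ?thesis using p by simp
  qed
qed

text \<open>\<open>A\<close> rescales the second basis vector; \<open>A'\<close> also exchanges the
  two vectors, and the scalar \<open>inverse p\<close> restores the leading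
  \<open>1\<close>.\<close>

lemma diagonal_mem_G1_orbitI:
  fixes p p' h :: 'a
  assumes "p \<noteq> 0" "h \<noteq> 0" and "p' = p * h ^ (2 ^ s + 1) \<or> p' = inverse p * h ^ (2 ^ s + 1)"
  shows "(1, 0, 0, p') \<in> G1_orbit s (1, 0, 0, p)"
proof -
  obtain A :: "'a ^ 2 ^ 2" where A: "A $ 1 $ 1 = 1" "A $ 1 $ 2 = 0" "A $ 2 $ 1 = 0" "A $ 2 $ 2 = h"
    using ex_matrix_2[of 1 0 0 h] by blast
  obtain A' :: "'a ^ 2 ^ 2" where A': "A' $ 1 $ 1 = 0" "A' $ 1 $ 2 = h" "A' $ 2 $ 1 = 1" "A' $ 2 $ 2 = 0"
    using ex_matrix_2[of 0 h 1 0] by blast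
  have inv: "invertible A" "invertible A'"
    using assms by (auto simp: invertible_det_nz det_2 A A')
  have "(1, 0, 0, p') = G1_act s (A, 1) (1, 0, 0, p)
      \<or> (1, 0, 0, p') = G1_act s (A', inverse p) (1, 0, 0, p)"
    using assms by (auto simp: G1_act_def scalar_act_def matrix_act_def Let_def A A' zero_power mult_ac)
  moreover have "inverse p \<noteq> 0" "(1::'a) \<noteq> 0" using assms(1) by simp_all
  ultimately show ?thesis using inv unfolding mem_G1_orbit_iff by blast
qed

end

subsection \<open>Counting the orbits\<close>

lemma plus_one_dvd_power: "(a::int) + 1 dvd a ^ n - (- 1) ^ n"
  using power_diff_sumr2[of a n "- 1"] by simp

text \<open>Write \<open>m = d M\<close> and \<open>s = d S\<close> with coprime \<open>M\<close>,
  \<open>S\<close>: as \<open>M\<close> is even, \<open>S\<close> is odd, and \<open>2^d + 1\<close>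
  divides both \<open>2^m - 1\<close> and \<open>2^s + 1\<close>.\<close>

lemma (in binary_field) roots_of_unity_eq:
  assumes "m \<ge> 1" and "even (m div gcd m s)"
  shows "{x::'a. x ^ (2 ^ s + 1) = 1} = {x. x ^ (2 ^ gcd m s + 1) = 1}"
    and "(2 ^ gcd m s + 1) dvd CARD('a) - 1"
proof -
  define d where "d = gcd m s"
  have "d > 0" using assms(1) by (simp add: d_def)
  have "\<exists>M S. m = M * d \<and> s = S * d \<and> coprime M S"
    unfolding d_def by (rule gcd_coprime_exists) (use assms(1) in simp)
  then obtain M S where MS: "m = d * M" "s = d * S" "coprime M S" by (metis mult.commute)
  have "m div d = M" using MS(1) \<open>d > 0\<close> by simp
  then have "even M" using assms(2) by (simp add: d_def)
  then have "odd S" using coprime_common_divisor[OF MS(3), of 2] by auto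
  then have "s \<noteq> 0" using MS(2) \<open>d > 0\<close> by (auto elim: oddE)
  have "int (2 ^ d + 1) dvd int (2 ^ m - 1)"
    using plus_one_dvd_power[of "2 ^ d" M] \<open>even M\<close> by (simp add: MS(1) of_nat_diff power_mult add.commute)
  then show "(2 ^ gcd m s + 1) dvd CARD('a) - 1"
    by (simp only: int_dvd_int_iff card_field flip: d_def)
  have "int (2 ^ d + 1) dvd int (2 ^ s + 1)"
    using plus_one_dvd_power[of "2 ^ d" S] \<open>odd S\<close> by (simp add: MS(2) power_mult add.commute)
  then have "(2 ^ d + 1 :: nat) dvd 2 ^ s + 1" by (simp only: int_dvd_int_iff)
  then obtain j :: nat where j: "2 ^ s + 1 = (2 ^ d + 1) * j" by (rule dvdE)
  \<comment> \<open>Applying \<open>\<sigma>\<close> \<open>u\<close> times amounts to raising to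
    the power \<open>2 ^ d\<close>. Each application inverts a root of unity \<open>x\<close>, and
    \<open>u\<close> turns out odd, so \<open>x ^ 2 ^ d = inverse x\<close>.\<close>
  obtain u v where uv: "s * u = m * v + d"
    using bezout_nat[OF \<open>s \<noteq> 0\<close>, of m] by (auto simp: d_def gcd.commute)
  show "{x::'a. x ^ (2 ^ s + 1) = 1} = {x. x ^ (2 ^ gcd m s + 1) = 1}"
  proof (intro equalityI subsetI)
    fix x :: 'a assume "x \<in> {x. x ^ (2 ^ gcd m s + 1) = 1}"
    then have "x ^ (2 ^ d + 1) = 1" by (simp add: d_def)
    then have "x ^ (2 ^ s + 1) = 1" unfolding j power_mult by simp
    then show "x \<in> {x. x ^ (2 ^ s + 1) = 1}" by simp
  next
    fix x :: 'a assume "x \<in> {x. x ^ (2 ^ s + 1) = 1}"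
    then have x: "x ^ 2 ^ s * x = 1" by (simp add: mult.commute)
    then have "x \<noteq> 0" by auto
    have inv: "x ^ 2 ^ s = inverse x" using x \<open>x \<noteq> 0\<close> by (simp add: field_simps)
    have su: "x ^ 2 ^ (s * n) = (if even n then x else inverse x)" for n
      by (induction n) (auto simp: power_add power_mult inv power_inverse)
    have mv: "x ^ 2 ^ (m * n) = x" for n
      by (induction n) (auto simp: power_add power_mult frob_m)
    have "d * (S * u) = d * (M * v + 1)" using uv MS by (simp add: algebra_simps)
    then have "S * u = M * v + 1" using \<open>d > 0\<close> by (subst (asm) mult_left_cancel) simp_all
    then have "odd u" using \<open>even M\<close> by (metis even_mult_iff even_plus_one_iff)
    then have "inverse x = x ^ 2 ^ (m * v + d)" using su[of u] uv by simp
    also have "\<dots> = x ^ 2 ^ d" by (simp only: power_add power_mult[of x "2 ^ (m * v)"] mv)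
    finally have "x ^ (2 ^ d + 1) = 1" using \<open>x \<noteq> 0\<close> by (simp add: field_simps)
    then show "x \<in> {x. x ^ (2 ^ gcd m s + 1) = 1}" by (simp add: d_def)
  qed
qed

context binary_field
begin

text \<open>For \<open>s > 0\<close> the power \<open>p ^ \<sigma>\<close> is a power of
  \<open>p * p\<close>, and \<open>p = p ^ (\<sigma> + 1) / p ^ \<sigma>\<close>. This separates the
  cosets of \<open>p\<close> and \<open>inverse p\<close>.\<close>

lemma square_mem_unit_powers_iff:
  fixes p :: 'a
  assumes "p \<noteq> 0" and "s > 0"
  shows "p * p \<in> unit_powers (2 ^ s + 1) \<longleftrightarrow> p \<in> unit_powers (2 ^ s + 1)"
proof
  assume "p * p \<in> unit_powers (2 ^ s + 1)"
  then obtain z where "z \<noteq> 0" "p * p = z ^ (2 ^ s + 1)" unfolding unit_powers_def by blast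
  then have "(p * p) ^ n = (z ^ n) ^ (2 ^ s + 1) \<and> z ^ n \<noteq> 0" for n
    by (metis mult.commute power_mult power_not_zero)
  then have "(p * p) ^ n \<in> unit_powers (2 ^ s + 1)" for n
    by (metis power_in_unit_powers)
  moreover obtain r where "s = Suc r" using assms(2) by (cases s) auto
  ultimately have "p ^ 2 ^ s \<in> unit_powers (2 ^ s + 1)"
    by (simp add: power_mult power2_eq_square)
  then have "p ^ (2 ^ s + 1) * inverse (p ^ 2 ^ s) \<in> unit_powers (2 ^ s + 1)"
    using assms(1) by (intro unit_powers_mult unit_powers_inverse power_in_unit_powers)
  moreover have "p ^ (2 ^ s + 1) * inverse (p ^ 2 ^ s) = p" using assms(1) by simp
  ultimately show "p \<in> unit_powers (2 ^ s + 1)" by metis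
qed (rule unit_powers_mult)

text \<open>The units outside \<open>H\<close> parametrise the legitimate diagonal quadruples; every
  orbit contains some of these, and they fill two distinct cosets of \<open>H\<close>.\<close>

lemma card_G1_orbits:
  assumes diag: "\<And>t :: 'a quadruple. legitimate s t \<Longrightarrow> \<exists>p. (1, 0, 0, p) \<in> G1_orbit s t"
    and "s > 0"
  shows "CARD('a) - 1 = (2 * card (G1_orbits s :: 'a quadruple set set) + 1)
    * card (unit_powers (2 ^ s + 1) :: 'a set)"
proof -
  define H where "H = (unit_powers (2 ^ s + 1) :: 'a set)"
  define X where "X = {p. p \<noteq> 0 \<and> p \<notin> H}"
  define orb where "orb p = G1_orbit s (1, 0, 0, p :: 'a)" for p
  have X: "p \<in> X \<longleftrightarrow> legitimate s (1, 0, 0, p)" for p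
    by (simp only: legitimate_diagonal_iff) (simp add: X_def H_def)
  have orbits: "G1_orbits s = orb ` X"
  proof (intro equalityI subsetI)
    fix O' :: "'a quadruple set" assume "O' \<in> G1_orbits s"
    then obtain t where t: "O' = G1_orbit s t" "legitimate s t" by (auto simp: G1_orbits_def Omega_def)
    then obtain p where "(1, 0, 0, p) \<in> G1_orbit s t" using diag by blast
    then have "O' = orb p" "p \<in> X" using t G1_orbit_eq_iff legitimate_G1_orbit X by (auto simp: orb_def)
    then show "O' \<in> orb ` X" by blast
  next
    fix O' :: "'a quadruple set" assume "O' \<in> orb ` X"
    then obtain p where "O' = orb p" "p \<in> X" by blast
    then show "O' \<in> G1_orbits s" unfolding G1_orbits_def Omega_def X orb_def by blast
  qed
  have fibre: "card {p' \<in> X. orb p' = orb p} = 2 * card H" if "p \<in> X" for p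
  proof -
    have p: "p \<noteq> 0" "p \<notin> H" using that by (auto simp: X_def)
    have "{p' \<in> X. orb p' = orb p} = (*) p ` H \<union> (*) (inverse p) ` H"
    proof (intro equalityI subsetI)
      fix p' assume "p' \<in> {p' \<in> X. orb p' = orb p}"
      then have "(1, 0, 0, p') \<in> G1_orbit s (1, 0, 0, p)"
        unfolding orb_def by (metis (lifting) G1_orbit_refl mem_Collect_eq)
      then have "p' / p \<in> H \<or> p' * p \<in> H"
        using diagonal_mem_G1_orbit_imp p by (simp only: H_def)
      moreover have "p' = p * (p' / p)" "p' = inverse p * (p' * p)" using p by simp_all
      ultimately show "p' \<in> (*) p ` H \<union> (*) (inverse p) ` H" by blast
    next
      fix p' assume "p' \<in> (*) p ` H \<union> (*) (inverse p) ` H"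
      then obtain h where "h \<noteq> 0" "p' = p * h ^ (2 ^ s + 1) \<or> p' = inverse p * h ^ (2 ^ s + 1)"
        by (auto simp: H_def unit_powers_def)
      then have "(1, 0, 0, p') \<in> G1_orbit s (1, 0, 0, p)"
        using diagonal_mem_G1_orbitI p(1) by blast
      then show "p' \<in> {p' \<in> X. orb p' = orb p}"
        using that X legitimate_G1_orbit G1_orbit_eq_iff unfolding orb_def by blast
    qed
    moreover have "(*) p ` H \<inter> (*) (inverse p) ` H = {}"
    proof (rule ccontr)
      assume "\<not> ?thesis"
      then obtain h h' where hh: "h \<in> H" "h' \<in> H" "p * h = inverse p * h'" by blast
      then have "p * p = h' * inverse h"
        using p unit_powers_nonzero[of h "2 ^ s + 1"] by (simp add: field_simps H_def)
      then have "p * p \<in> H" using hh unit_powers_mult unit_powers_inverse unfolding H_def by metis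
      then show False using p square_mem_unit_powers_iff[OF p(1) \<open>s > 0\<close>] by (simp add: H_def)
    qed
    moreover have "card ((*) p ` H) = card H" "card ((*) (inverse p) ` H) = card H"
      using p by (auto intro!: card_image inj_onI)
    ultimately show ?thesis by (simp add: card_Un_disjoint)
  qed
  have "card X = 2 * card H * card (orb ` X)"
    by (rule card_fibres_eq) (auto simp: fibre)
  moreover have "UNIV - {0} = X \<union> H" "X \<inter> H = {}"
    by (auto simp: X_def H_def dest: unit_powers_nonzero)
  then have "CARD('a) - 1 = card X + card H"
    by (metis card_units card_Un_disjoint finite)
  ultimately show ?thesis by (simp add: orbits H_def algebra_simps)
qed

end

theorem theorem5:
  fixes m s :: nat
  assumes "m \<ge> 1"
    and "CARD('a::{field,finite}) = 2 ^ m"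
    and "s < 2 * m"
    and "even (m div gcd m s)"
  shows "(\<forall>l::'a. l \<noteq> 0 \<longrightarrow> l \<notin> sigma_powers s \<longrightarrow>
            (\<forall>t \<in> Omega s. B s l t \<in> C_family s))
         \<and> card (G1_orbits s :: 'a quadruple set set) = 2 ^ (gcd m s - 1)"
proof -
  interpret binary_field m "TYPE('a)" by unfold_locales (rule assms)
  define d where "d = gcd m s"
  have "d > 0" using assms(1) by (simp add: d_def)
  \<comment> \<open>For \<open>s = 0\<close> the quotient \<open>m div gcd m s\<close> would be
    \<open>1\<close>, which is odd.\<close>
  have "s > 0" using assms(1,4) by (cases s) auto
  have dvd: "2 ^ d + 1 dvd CARD('a) - 1"
    using roots_of_unity_eq(2)[OF assms(1,4)] by (simp only: d_def)
  have R: "card {x::'a. x ^ (2 ^ s + 1) = 1} = 2 ^ d + 1"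
    using card_roots_of_unity[OF dvd] roots_of_unity_eq(1)[OF assms(1,4)] by (simp add: d_def)
  have "(2::nat) ^ d \<ge> 2" using power_increasing[of 1 d "2::nat"] \<open>d > 0\<close> by simp
  then have R2: "card {x::'a. x ^ (2 ^ s + 1) = 1} > 2" unfolding R by simp
  have R1: "card {x::'a. x ^ (2 ^ s + 1) = 1} dvd 2 ^ m - 1" using dvd R card_field by simp
  have diag: "\<exists>p. (1, 0, 0, p) \<in> G1_orbit s t" if "legitimate s t" for t :: "'a quadruple"
    using ex_diagonal_in_G1_orbit[OF that R1 R2] .
  have "B s l t \<in> C_family s" if l: "l \<noteq> 0" "l \<notin> sigma_powers s" and "t \<in> Omega s"
    for l :: 'a and t
  proof -
    have leg: "legitimate s t" using \<open>t \<in> Omega s\<close> by (simp add: Omega_def)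
    obtain p where p: "(1, 0, 0, p) \<in> G1_orbit s t" using diag[OF leg] by blast
    have "legitimate s (1, 0, 0, p)" using legitimate_G1_orbit[OF leg p] .
    moreover have "isotopic (B s l (1, 0, 0, p)) (B s l t)"
      using isotopic_B_G1_orbit G1_orbit_sym[OF p] by blast
    ultimately show ?thesis
      using presemifield_B[OF leg l(2)] l unfolding C_family_def by blast
  qed
  moreover have "card (G1_orbits s :: 'a quadruple set set) = 2 ^ (gcd m s - 1)"
  proof -
    define H where "H = (unit_powers (2 ^ s + 1) :: 'a set)"
    have "1 \<in> H" using power_in_unit_powers[of 1 "2 ^ s + 1"] by (simp add: H_def)
    then have "card H > 0" by (auto simp: card_gt_0_iff)
    have "{x::'a. x ^ (2 ^ s + 1) = 1 \<and> x \<noteq> 0} = {x. x ^ (2 ^ s + 1) = 1}" by auto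
    \<comment> \<open>Both sides count the units: by kernel and image of the power map, and by
      orbits.\<close>
    then have "(2 ^ d + 1) * card H = (2 * card (G1_orbits s :: 'a quadruple set set) + 1) * card H"
      using card_units_eq_mult[of "2 ^ s + 1", where 'a='a] card_G1_orbits[OF diag \<open>s > 0\<close>] R
      by (simp only: H_def)
    then have "2 ^ d = 2 * card (G1_orbits s :: 'a quadruple set set)" using \<open>card H > 0\<close>
      by (subst (asm) mult_cancel2) linarith
    moreover have "(2::nat) ^ d = 2 * 2 ^ (d - 1)" using \<open>d > 0\<close> by (cases d) auto
    ultimately show ?thesis by (simp add: d_def)
  qed
  ultimately show ?thesis by blast
qed

end
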